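(* Let $V$ be a generalized vertex algebra with a charge factor $(Q,\Delta,\eta)$, and let $B$ be a totally ordered set with a map $i:B\to V$ such that every element of $i(B)$ is a non-zero $Q$-homogeneous vector and $i(B)$ generates $V$. Let $\mathcal{N}:B\times B\to\mathbb{C}$ be a symmetric map such that for all $a,b\in B$ the number $\mathcal{N}(a,b)$ is a locality bound of the fields $Y(i(a),z)$ and $Y(i(b),z)$. Then the set $\mathcal{C}(V,B,\mathcal{N})$ of all vectors $$\Psi(a_1,m_1;\cdots;a_k,m_k)=a_k\bigl(m_k+\textstyle\sum_{j=1}^{k-1}\mathcal{N}(a_k,a_j)\bigr)\cdots a_2\bigl(m_2+\mathcal{N}(a_2,a_1)\bigr)\,a_1(m_1)\,|0\rangle$$ with $k\ge0$, $a_1\le\cdots\le a_k$ in $B$ and negative integers $m_1,\ldots,m_k$ such that $m_i\ge m_j$ whenever $i<j$ and $a_i=a_j$, spans the vector space $V$.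
   Context: All vector spaces are over a field $\mathbf{k}\supseteq\mathbb{C}$. In the claim $a\in B$ stands for $i(a)\in V$, and the monomial for $k=0$ is $|0\rangle$. GVAs. $U[[z,z^{\mathbb{C}}]]$ is the space of formal series $\sum_{n\in\mathbb{C}}f(n)z^n$ with $f(n)\in U$; for a coset $\Gamma\in\mathbb{C}/\mathbb{Z}$, $U[[z]]z^\Gamma$ is the space of finite sums of $\psi(z)z^d$ with $d\in\Gamma$, $\psi\in U[[z]]$. Put $\iota_{z,w}(z-w)^N=\sum_{j\ge0}\binom Nj z^{N-j}(-w)^j$ and $\iota_{w,z}(z-w)^N=e^{\pi iN}\sum_{j\ge0}\binom Nj w^{N-j}(-z)^j$. A weak GVA $(V,Y,|0\rangle,T)$ is a vector space $V$ with a non-zero vector $|0\rangle$, $T\in\mathrm{End}(V)$ and a linear map $Y:V\to\mathrm{End}(V)[[z,z^{\mathbb{C}}]]$, $Y(a,z)=\sum_{n\in\mathbb{C}}a(n)z^{-n-1}$, such that $T|0\rangle=0$, $Y(a,z)|0\rangle|_{z=0}=a$ (in particular $Y(a,z)|0\rangle\in V[[z]]$) and $[T,Y(a,z)]=\partial_zY(a,z)$. Given an abelian group $Q$, a symmetric biadditive $\Delta:Q\times Q\to\mathbb{C}/\mathbb{Z}$ and a grading $V=\bigoplus_{\alpha\in Q}V^\alpha$, a field of charge $\alpha$ is a series $a(z)\in\mathrm{End}(V)[[z,z^{\mathbb{C}}]]$ with $a(z)b\in V^{\alpha+\beta}[[z]]z^{-\Delta(\alpha,\beta)}$ for $b\in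 V^\beta$. Fields $a(z),b(z)$ of charges $\alpha,\beta$ are mutually $p$-local ($p\in\mathbb{C}^\times$) if there is $N\in\Delta(\alpha,\beta)$, called a locality bound, with $\iota_{z,w}(z-w)^Na(z)b(w)=p\,\iota_{w,z}(z-w)^Nb(w)a(z)$. A generalized vertex algebra (GVA) is a weak GVA admitting a charge factor $(Q,\Delta,\eta)$: an abelian group $Q$, a symmetric biadditive $\Delta$, a grading $V=\bigoplus_{\alpha\in Q}V^\alpha$ and a bimultiplicative $\eta:Q\times Q\to\mathbb{C}^\times$ with $\eta(\alpha,\beta)\eta(\beta,\alpha)=e^{-2\pi i\Delta(\alpha,\beta)}$, such that $|0\rangle\in V^0$, $T$ preserves the grading, $Y(a,z)$ is a field of charge $\alpha$ for $a\in V^\alpha$, and $Y(a,z),Y(b,z)$ are mutually $\eta(\alpha,\beta)$-local for $a\in V^\alpha,b\in V^\beta$. For $Y(i(a),z)$ and $Y(i(b),z)$, a locality bound is meant with $p=\eta(\alpha,\beta)$, where $\alpha,\beta$ are the charges of $i(a),i(b)$. A subset generates $V$ if the smallest $T$-invariant subspace containing it and $|0\rangle$ and closed under all products $u(n)v$ ($n\in\mathbb{C}$) is $V$. *)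

theory Defs
  imports Complex_Main "HOL-Library.Groups_Big_Fun" "HOL-Library.Set_Algebras"
begin

text \<open>
  A series \<open>\<Sum>n. f(n) z^n\<close> with exponents in \<open>\<complex>\<close> is its coefficient function.
\<close>

type_synonym 'u fseries = "complex \<Rightarrow> 'u"

definition power_series :: "'u::zero set \<Rightarrow> 'u fseries set"  \<comment> \<open>\<open>U[[z]]\<close>\<close>
  where "power_series U = {f. (\<forall>n. f n \<in> U) \<and> (\<forall>n. f n \<noteq> 0 \<longrightarrow> n \<in> \<nat>)}"

definition shifted_power_series ::
    "'u::comm_monoid_add set \<Rightarrow> complex set \<Rightarrow> 'u fseries set"  \<comment> \<open>\<open>U[[z]] z^\<Gamma>\<close>\<close>
  where "shifted_power_series U \<Gamma> =
    {f. \<exists>(K::nat) d \<psi>. (\<forall>k<K. d k \<in> \<Gamma> \<and> \<psi> k \<in> power_series U) \<and>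
          f = (\<lambda>n. \<Sum>k<K. \<psi> k (n - d k))}"

text \<open>\<open>\<complex>/\<int>\<close> as the set of cosets; coset addition is the setwise sum.\<close>

definition complex_mod_int :: "complex set set"
  where "complex_mod_int = UNIV // {(x, y). x - y \<in> \<int>}"

text \<open>
  \<open>Y a n\<close> is the coefficient of \<open>z^n\<close> in \<open>Y(a,z)\<close>, whereas the mode \<open>a(n)\<close> is the
  coefficient of \<open>z^(-n-1)\<close>.
\<close>

definition mode :: "('v \<Rightarrow> ('v \<Rightarrow> 'v) fseries) \<Rightarrow> 'v \<Rightarrow> complex \<Rightarrow> 'v \<Rightarrow> 'v"
  where "mode Y a n = Y a (- n - 1)"

text \<open>The scalar field is an extension of \<open>\<complex>\<close> via the field homomorphism \<open>emb\<close>.\<close>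

locale vector_space_over_complex_extension = vector_space scale
  for scale :: "'k::field \<Rightarrow> 'v::ab_group_add \<Rightarrow> 'v" +
  fixes emb :: "complex \<Rightarrow> 'k"
  assumes emb_add: "emb (x + y) = emb x + emb y"
    and emb_mult: "emb (x * y) = emb x * emb y"
    and emb_one: "emb 1 = 1"

locale weak_GVA = vector_space_over_complex_extension scale emb
  for scale :: "'k::field \<Rightarrow> 'v::ab_group_add \<Rightarrow> 'v" and emb :: "complex \<Rightarrow> 'k" +
  fixes Y :: "'v \<Rightarrow> ('v \<Rightarrow> 'v) fseries" and vac :: 'v and T :: "'v \<Rightarrow> 'v"
  assumes vac_nonzero: "vac \<noteq> 0"
    and T_linear: "Vector_Spaces.linear scale scale T"
    and Y_endo: "Vector_Spaces.linear scale scale (Y a n)"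
    and Y_linear: "Vector_Spaces.linear scale scale (\<lambda>a. Y a n b)"
    and T_vac: "T vac = 0"
    and Y_vac_power_series: "(\<lambda>n. Y a n vac) \<in> power_series UNIV"
    and Y_vac_at_0: "Y a 0 vac = a"
    and T_commutator:  \<comment> \<open>\<open>[T, Y(a,z)] = \<partial>\<^sub>z Y(a,z)\<close>, coefficient of \<open>z^n\<close>\<close>
      "T (Y a n b) - Y a n (T b) = scale (emb (n + 1)) (Y a (n + 1) b)"

definition is_grading ::
    "('k::field \<Rightarrow> 'v::ab_group_add \<Rightarrow> 'v) \<Rightarrow> ('q \<Rightarrow> 'v set) \<Rightarrow> bool"
  where "is_grading scale Vg \<longleftrightarrow>
    (\<forall>\<alpha>. module.subspace scale (Vg \<alpha>)) \<and>
    (\<forall>v. \<exists>!f. (\<forall>\<alpha>. f \<alpha> \<in> Vg \<alpha>) \<and> finite {\<alpha>. f \<alpha> \<noteq> 0} \<and> v = (\<Sum>\<alpha> | f \<alpha> \<noteq> 0. f \<alpha>))"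

definition is_field ::
    "('k::field \<Rightarrow> 'v::ab_group_add \<Rightarrow> 'v) \<Rightarrow> ('q::ab_group_add \<Rightarrow> 'q \<Rightarrow> complex set) \<Rightarrow>
     ('q \<Rightarrow> 'v set) \<Rightarrow> 'q \<Rightarrow> ('v \<Rightarrow> 'v) fseries \<Rightarrow> bool"
  where "is_field scale \<Delta> Vg \<alpha> a \<longleftrightarrow>
    (\<forall>n. Vector_Spaces.linear scale scale (a n)) \<and>
    (\<forall>\<beta>. \<forall>b\<in>Vg \<beta>. (\<lambda>n. a n b) \<in> shifted_power_series (Vg (\<alpha> + \<beta>)) (uminus ` \<Delta> \<alpha> \<beta>))"

text \<open>
  With \<open>\<iota>\<^sub>z\<^sub>,\<^sub>w (z-w)^N = \<Sum>j. (N choose j) z^(N-j) (-w)^j\<close>, the following is the coefficient of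
  \<open>z^r w^s\<close> in \<open>\<iota>\<^sub>z\<^sub>,\<^sub>w (z-w)^N a(z) b(w) c\<close>. If \<open>b\<close> is a field, then \<open>b (s - j) c = 0\<close> for almost
  all \<open>j\<close>, so only finitely many summands are non-zero, as \<^const>\<open>Sum_any\<close> requires.
\<close>

definition iota_product_coeff ::
    "('k::field \<Rightarrow> 'v::ab_group_add \<Rightarrow> 'v) \<Rightarrow> (complex \<Rightarrow> 'k) \<Rightarrow> complex \<Rightarrow>
     ('v \<Rightarrow> 'v) fseries \<Rightarrow> ('v \<Rightarrow> 'v) fseries \<Rightarrow> complex \<Rightarrow> complex \<Rightarrow> 'v \<Rightarrow> 'v"
  where "iota_product_coeff scale emb N a b r s c =
    (Sum_any (\<lambda>j::nat. scale (emb ((N gchoose j) * (-1) ^ j)) (a (r - (N - of_nat j)) (b (s - of_nat j) c))))"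

text \<open>
  Since \<open>\<iota>\<^sub>w\<^sub>,\<^sub>z (z-w)^N = exp (\<pi>\<i>N) \<Sum>j. (N choose j) w^(N-j) (-z)^j\<close>, the coefficient of \<open>z^r w^s\<close> in
  \<open>\<iota>\<^sub>w\<^sub>,\<^sub>z (z-w)^N b(w) a(z) c\<close> is \<open>exp (\<pi>\<i>N)\<close> times the expression above with \<open>a\<close>, \<open>b\<close>
  and \<open>r\<close>, \<open>s\<close> exchanged. The notion is meant for fields \<open>a\<close>, \<open>b\<close> of charges \<open>\<alpha>\<close>, \<open>\<beta>\<close>.
\<close>

definition is_locality_bound ::
    "('k::field \<Rightarrow> 'v::ab_group_add \<Rightarrow> 'v) \<Rightarrow> (complex \<Rightarrow> 'k) \<Rightarrow> ('q \<Rightarrow> 'q \<Rightarrow> complex set) \<Rightarrow>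
     complex \<Rightarrow> 'q \<Rightarrow> 'q \<Rightarrow> ('v \<Rightarrow> 'v) fseries \<Rightarrow> ('v \<Rightarrow> 'v) fseries \<Rightarrow> complex \<Rightarrow> bool"
  where "is_locality_bound scale emb \<Delta> p \<alpha> \<beta> a b N \<longleftrightarrow>
    N \<in> \<Delta> \<alpha> \<beta> \<and>
    (\<forall>r s c. iota_product_coeff scale emb N a b r s c =
       scale (emb (p * exp (of_real pi * \<i> * N))) (iota_product_coeff scale emb N b a s r c))"

text \<open>A generalized vertex algebra together with a charge factor \<open>(Q, \<Delta>, \<eta>)\<close>.\<close>

locale GVA_charge_factor = weak_GVA scale emb Y vac T
  for scale :: "'k::field \<Rightarrow> 'v::ab_group_add \<Rightarrow> 'v" and emb :: "complex \<Rightarrow> 'k"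
    and Y :: "'v \<Rightarrow> ('v \<Rightarrow> 'v) fseries" and vac :: 'v and T :: "'v \<Rightarrow> 'v" +
  fixes \<Delta> :: "'q::ab_group_add \<Rightarrow> 'q \<Rightarrow> complex set"
    and \<eta> :: "'q \<Rightarrow> 'q \<Rightarrow> complex"
    and Vg :: "'q \<Rightarrow> 'v set"
  assumes \<Delta>_coset: "\<Delta> \<alpha> \<beta> \<in> complex_mod_int"
    and \<Delta>_sym: "\<Delta> \<alpha> \<beta> = \<Delta> \<beta> \<alpha>"
    and \<Delta>_add_left: "\<Delta> (\<alpha> + \<beta>) \<gamma> = \<Delta> \<alpha> \<gamma> + \<Delta> \<beta> \<gamma>"
    and \<Delta>_add_right: "\<Delta> \<alpha> (\<beta> + \<gamma>) = \<Delta> \<alpha> \<beta> + \<Delta> \<alpha> \<gamma>"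
    and \<eta>_nonzero: "\<eta> \<alpha> \<beta> \<noteq> 0"
    and \<eta>_mult_left: "\<eta> (\<alpha> + \<beta>) \<gamma> = \<eta> \<alpha> \<gamma> * \<eta> \<beta> \<gamma>"
    and \<eta>_mult_right: "\<eta> \<alpha> (\<beta> + \<gamma>) = \<eta> \<alpha> \<beta> * \<eta> \<alpha> \<gamma>"
    and \<eta>_\<Delta>: "d \<in> \<Delta> \<alpha> \<beta> \<Longrightarrow> \<eta> \<alpha> \<beta> * \<eta> \<beta> \<alpha> = exp (- 2 * of_real pi * \<i> * d)"
    and grading: "is_grading scale Vg"
    and vac_degree: "vac \<in> Vg 0"
    and T_degree: "v \<in> Vg \<alpha> \<Longrightarrow> T v \<in> Vg \<alpha>"
    and Y_field: "a \<in> Vg \<alpha> \<Longrightarrow> is_field scale \<Delta> Vg \<alpha> (Y a)"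
    and Y_local: "a \<in> Vg \<alpha> \<Longrightarrow> b \<in> Vg \<beta> \<Longrightarrow>
      \<exists>N. is_locality_bound scale emb \<Delta> (\<eta> \<alpha> \<beta>) \<alpha> \<beta> (Y a) (Y b) N"

definition generates ::
    "('k::field \<Rightarrow> 'v::ab_group_add \<Rightarrow> 'v) \<Rightarrow> ('v \<Rightarrow> ('v \<Rightarrow> 'v) fseries) \<Rightarrow> 'v \<Rightarrow>
     ('v \<Rightarrow> 'v) \<Rightarrow> 'v set \<Rightarrow> bool"
  where "generates scale Y vac T S \<longleftrightarrow>
    (\<lambda>W. module.subspace scale W \<and> T ` W \<subseteq> W \<and> (\<forall>u\<in>W. \<forall>v\<in>W. \<forall>n. mode Y u n v \<in> W))
      hull (insert vac S) = UNIV"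

text \<open>
  \<open>\<Psi>(a\<^sub>1,m\<^sub>1; \<dots>; a\<^sub>k,m\<^sub>k)\<close>, with the indices shifted to \<open>0, \<dots>, k - 1\<close>; the values of the
  sequences \<open>a\<close> and \<open>m\<close> from \<open>k\<close> on are irrelevant.
\<close>

primrec Psi ::
    "('v \<Rightarrow> ('v \<Rightarrow> 'v) fseries) \<Rightarrow> 'v \<Rightarrow> ('b \<Rightarrow> 'v) \<Rightarrow> ('b \<Rightarrow> 'b \<Rightarrow> complex) \<Rightarrow>
     (nat \<Rightarrow> 'b) \<Rightarrow> (nat \<Rightarrow> int) \<Rightarrow> nat \<Rightarrow> 'v"
  where
    "Psi Y vac \<iota> \<N> a m 0 = vac"
  | "Psi Y vac \<iota> \<N> a m (Suc k) =
       mode Y (\<iota> (a k)) (of_int (m k) + (\<Sum>j<k. \<N> (a k) (a j))) (Psi Y vac \<iota> \<N> a m k)"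

definition ordered_monomials ::  \<comment> \<open>\<open>\<C>(V, B, \<N>)\<close>\<close>
    "('v \<Rightarrow> ('v \<Rightarrow> 'v) fseries) \<Rightarrow> 'v \<Rightarrow> 'b::linorder set \<Rightarrow> ('b \<Rightarrow> 'v) \<Rightarrow>
     ('b \<Rightarrow> 'b \<Rightarrow> complex) \<Rightarrow> 'v set"
  where "ordered_monomials Y vac B \<iota> \<N> =
    {Psi Y vac \<iota> \<N> a m k | a m k.
       (\<forall>j<k. a j \<in> B \<and> m j < 0) \<and>
       (\<forall>j<k. \<forall>i<j. a i \<le> a j \<and> (a i = a j \<longrightarrow> m i \<ge> m j))}"

end

theory Submission
  imports Defs
begin

text \<open>
  Monomials in the generators span \<open>V\<close>: their span \<open>W\<close> is invariant under \<open>T\<close> and under the modes of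
  the generators, and locality of a homogeneous \<open>u \<in> W\<close> with a generator \<open>b\<close> rewrites \<open>u(n) b(m) x\<close>
  in terms of \<open>b(m') u(n') x\<close> and of \<open>u(n') b(m + j) x\<close> with \<open>j > 0\<close>, which vanishes for large \<open>j\<close>.

  To order the monomials, write \<open>n\<^sub>i = - m\<^sub>i - 1\<close>. With the mode shifts by \<open>\<N>\<close>, locality of neighbouring
  generators \<open>b\<close> (inner) and \<open>a\<close> (outer) becomes
  \<open>\<Sum>\<^sub>j c\<^sub>j \<Psi>(\<dots>; b, s - j; a, r + j; \<dots>) = p \<Sum>\<^sub>j c\<^sub>j \<Psi>(\<dots>; a, r - j; b, s + j; \<dots>)\<close> with \<open>c\<^sub>0 = 1\<close>.
  Every term other than the two leading ones has, for its own order of generators, exponents moved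
  outwards, which lowers the sum of all partial sums of the \<open>n\<^sub>i\<close>. A monomial with a negative partial
  sum vanishes: if the \<open>n\<^sub>i\<close> increase then \<open>n\<^sub>1 < 0\<close>, and a descent can be removed by the relation.
  So induction on the sum of partial sums terminates. It allows one to permute the generators, then to make
  all \<open>n\<^sub>i\<close> non-negative without increasing that sum, and finally to sort the exponents of equal
  generators.
\<close>

subsection \<open>Locality and charges\<close>

context vector_space_over_complex_extension
begin

lemma emb_nonzero: "x \<noteq> 0 \<Longrightarrow> emb x \<noteq> 0"
  using emb_mult[of x "inverse x"] emb_one by auto

lemma linear_span_into_span:
  assumes f: "Vector_Spaces.linear scale scale f"
    and x: "x \<in> span A"
    and A: "\<And>y. y \<in> A \<Longrightarrow> f y \<in> span U"
  shows "f x \<in> span U"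
proof -
  interpret f: Vector_Spaces.linear scale scale f by (rule f)
  show ?thesis
    using x
  proof (induction rule: span_induct_alt)
    case base
    show ?case by (simp add: f.zero span_zero)
  next
    case (step c y z)
    then show ?case by (simp add: f.add f.scale A span_add span_scale)
  qed
qed

lemma Sum_any_in_span: "(\<And>j. g j \<in> span A) \<Longrightarrow> Sum_any g \<in> span A"
  by (simp add: Sum_any.expand_set span_sum)

text \<open>The head is the total minus the other terms. Finite support matters: otherwise
  \<open>Sum_any\<close> takes the default value 0 and carries no information about
  \<open>g 0\<close>.\<close>

lemma Sum_any_head_in_span:
  fixes g :: "nat \<Rightarrow> 'v"
  assumes fin: "finite {j. g j \<noteq> 0}"
    and sum: "Sum_any g \<in> span A"
    and tail: "\<And>j. j > 0 \<Longrightarrow> g j \<in> span A"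
  shows "g 0 \<in> span A"
proof -
  have "Sum_any g = sum g (insert 0 {j. g j \<noteq> 0})"
    unfolding Sum_any.expand_set using fin by (intro sum.mono_neutral_left) auto
  also have "\<dots> = g 0 + sum g ({j. g j \<noteq> 0} - {0})"
    using fin by (simp add: sum.insert_remove)
  finally have "g 0 = Sum_any g - sum g ({j. g j \<noteq> 0} - {0})" by simp
  also have "\<dots> \<in> span A"
    using sum tail by (intro span_diff span_sum) auto
  finally show ?thesis .
qed

text \<open>The leading coefficient of \<open>\<iota>\<^sub>z\<^sub>,\<^sub>w (z-w)^N\<close> is 1, so locality can be solved for the leading product.\<close>

lemma locality_head_in_span:
  assumes loc: "is_locality_bound scale emb \<Delta> p \<alpha> \<beta> a b N"
    and a: "\<And>n. Vector_Spaces.linear scale scale (a n)"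
    and fin: "finite {j::nat. b (s - of_nat j) c \<noteq> 0}"
    and tail: "\<And>j::nat. j > 0 \<Longrightarrow> a (r + of_nat j) (b (s - of_nat j) c) \<in> span A"
    and swapped: "\<And>j::nat. b (s - N + of_nat j) (a (r + N - of_nat j) c) \<in> span A"
  shows "a r (b s c) \<in> span A"
proof -
  define g :: "nat \<Rightarrow> 'v" where "g j =
    scale (emb ((N gchoose j) * (-1) ^ j)) (a (r + of_nat j) (b (s - of_nat j) c))" for j
  \<comment> \<open>Taking the coefficient of \<open>z^(r + N) w^s\<close> makes the term
    \<open>j = 0\<close> exactly \<open>a r (b s c)\<close>.\<close>
  have "Sum_any g = iota_product_coeff scale emb N a b (r + N) s c"
    unfolding iota_product_coeff_def g_def by (simp add: algebra_simps)
  also have "\<dots> = scale (emb (p * exp (of_real pi * \<i> * N))) (iota_product_coeff scale emb N b a s (r + N) c)"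
    using loc unfolding is_locality_bound_def by blast
  also have "\<dots> \<in> span A"
    unfolding iota_product_coeff_def using swapped
    by (intro span_scale Sum_any_in_span) (simp add: algebra_simps)
  finally have sum: "Sum_any g \<in> span A" .
  have "a n 0 = 0" for n
  proof -
    interpret a: Vector_Spaces.linear scale scale "a n" by (rule a)
    show ?thesis by (rule a.zero)
  qed
  then have "{j. g j \<noteq> 0} \<subseteq> {j. b (s - of_nat j) c \<noteq> 0}"
    by (auto simp: g_def)
  then have "finite {j. g j \<noteq> 0}" using fin by (rule finite_subset)
  then have "g 0 \<in> span A" using sum
  proof (rule Sum_any_head_in_span)
    show "g j \<in> span A" if "j > 0" for j
      unfolding g_def using tail[OF that] by (rule span_scale)
  qed
  then show ?thesis by (simp add: g_def emb_one)
qed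

end

section \<open>Cosets of the integers\<close>

lemma complex_mod_int_cases: "\<Gamma> \<in> complex_mod_int \<Longrightarrow> \<exists>u. \<Gamma> = {y. u - y \<in> \<int>}"
  unfolding complex_mod_int_def quotient_def by auto

lemma complex_mod_int_eq:
  assumes "\<Gamma> \<in> complex_mod_int" "x \<in> \<Gamma>"
  shows "\<Gamma> = {y. x - y \<in> \<int>}"
proof -
  obtain u where \<Gamma>: "\<Gamma> = {y. u - y \<in> \<int>}"
    using complex_mod_int_cases[OF assms(1)] by blast
  have ux: "u - x \<in> \<int>" using assms(2) \<Gamma> by auto
  have "u - y \<in> \<int> \<longleftrightarrow> x - y \<in> \<int>" for y
  proof -
    have "u - y = (u - x) + (x - y)" "x - y = (u - y) - (u - x)" by simp_all
    then show ?thesis using ux by (metis Ints_add Ints_diff)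
  qed
  then show ?thesis using \<Gamma> by auto
qed

lemma finite_nat_shift: "finite {j::nat. x - of_nat j \<in> (\<nat> :: complex set)}"
proof -
  have "j \<le> nat \<lfloor>Re x\<rfloor>" if "x - of_nat j \<in> (\<nat> :: complex set)" for j
  proof -
    obtain m where "x - of_nat j = of_nat m" using \<open>x - of_nat j \<in> \<nat>\<close> by (auto elim: Nats_cases)
    then have "x = of_nat (m + j)" by (simp add: algebra_simps)
    then have "Re x = of_nat (m + j)" by simp
    then show ?thesis by simp
  qed
  then have "{j. x - of_nat j \<in> (\<nat> :: complex set)} \<subseteq> {..nat \<lfloor>Re x\<rfloor>}" by blast
  then show ?thesis by (rule finite_subset) (rule finite_atMost)
qed

section \<open>Degrees, truncation and coefficients at the vacuum\<close>

context GVA_charge_factor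
begin

lemma Y_0: "Y a n 0 = 0"
proof -
  interpret Vector_Spaces.linear scale scale "Y a n" by (rule Y_endo)
  show ?thesis by (rule zero)
qed

lemma subspace_Vg: "subspace (Vg \<alpha>)"
  using grading unfolding is_grading_def by blast

lemma field_expansion:
  assumes "a \<in> Vg \<alpha>" "b \<in> Vg \<beta>"
  obtains K :: nat and d \<psi> where "\<And>k. k < K \<Longrightarrow> - d k \<in> \<Delta> \<alpha> \<beta>"
    "\<And>k. k < K \<Longrightarrow> \<psi> k \<in> power_series (Vg (\<alpha> + \<beta>))"
    "\<And>n. Y a n b = (\<Sum>k<K. \<psi> k (n - d k))"
proof -
  have "(\<lambda>n. Y a n b) \<in> shifted_power_series (Vg (\<alpha> + \<beta>)) (uminus ` \<Delta> \<alpha> \<beta>)"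
    using Y_field[OF assms(1)] assms(2) unfolding is_field_def by blast
  then have "\<exists>(K::nat) d \<psi>. (\<forall>k<K. d k \<in> uminus ` \<Delta> \<alpha> \<beta> \<and> \<psi> k \<in> power_series (Vg (\<alpha> + \<beta>))) \<and>
      (\<lambda>n. Y a n b) = (\<lambda>n. \<Sum>k<K. \<psi> k (n - d k))"
    by (simp only: shifted_power_series_def mem_Collect_eq)
  then obtain K :: nat and d \<psi> where *: "\<forall>k<K. d k \<in> uminus ` \<Delta> \<alpha> \<beta> \<and> \<psi> k \<in> power_series (Vg (\<alpha> + \<beta>))"
    "(\<lambda>n. Y a n b) = (\<lambda>n. \<Sum>k<K. \<psi> k (n - d k))"
    by (elim exE conjE) (rule that)
  show ?thesis
  proof (rule that)
    show "- d k \<in> \<Delta> \<alpha> \<beta>" if "k < K" for k using *(1) that by force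
    show "\<psi> k \<in> power_series (Vg (\<alpha> + \<beta>))" if "k < K" for k using *(1) that by blast
    show "Y a n b = (\<Sum>k<K. \<psi> k (n - d k))" for n using *(2) by (rule fun_cong)
  qed
qed

lemma Y_degree:
  assumes "a \<in> Vg \<alpha>" "b \<in> Vg \<beta>"
  shows "Y a n b \<in> Vg (\<alpha> + \<beta>)"
proof -
  obtain K :: nat and d \<psi> where *: "\<And>k. k < K \<Longrightarrow> - d k \<in> \<Delta> \<alpha> \<beta>"
    "\<And>k. k < K \<Longrightarrow> \<psi> k \<in> power_series (Vg (\<alpha> + \<beta>))"
    "\<And>n. Y a n b = (\<Sum>k<K. \<psi> k (n - d k))"
    by (rule field_expansion[OF assms]) (rule that)
  show ?thesis
    unfolding *(3) using *(2)
    by (intro subspace_sum[OF subspace_Vg]) (auto simp: power_series_def)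
qed

lemma Y_exponent:
  assumes "a \<in> Vg \<alpha>" "b \<in> Vg \<beta>" "Y a n b \<noteq> 0"
  shows "\<exists>\<delta>\<in>\<Delta> \<alpha> \<beta>. n + \<delta> \<in> \<nat>"
proof -
  obtain K :: nat and d \<psi> where *: "\<And>k. k < K \<Longrightarrow> - d k \<in> \<Delta> \<alpha> \<beta>"
    "\<And>k. k < K \<Longrightarrow> \<psi> k \<in> power_series (Vg (\<alpha> + \<beta>))"
    "\<And>n. Y a n b = (\<Sum>k<K. \<psi> k (n - d k))"
    by (rule field_expansion[OF assms(1,2)]) (rule that)
  obtain k where "k < K" "\<psi> k (n - d k) \<noteq> 0"
    using assms(3) *(3) by (auto elim: sum.not_neutral_contains_not_neutral)
  then have "- d k \<in> \<Delta> \<alpha> \<beta>" "n + - d k \<in> \<nat>"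
    using *(1,2)[of k] by (auto simp: power_series_def)
  then show ?thesis by blast
qed

lemma Y_truncation:
  assumes "a \<in> Vg \<alpha>" "b \<in> Vg \<beta>"
  shows "finite {j::nat. Y a (s - of_nat j) b \<noteq> 0}"
proof -
  obtain K :: nat and d \<psi> where *: "\<And>k. k < K \<Longrightarrow> - d k \<in> \<Delta> \<alpha> \<beta>"
    "\<And>k. k < K \<Longrightarrow> \<psi> k \<in> power_series (Vg (\<alpha> + \<beta>))"
    "\<And>n. Y a n b = (\<Sum>k<K. \<psi> k (n - d k))"
    by (rule field_expansion[OF assms]) (rule that)
  have "{j::nat. Y a (s - of_nat j) b \<noteq> 0} \<subseteq> (\<Union>k<K. {j. (s - d k) - of_nat j \<in> \<nat>})"
  proof
    fix j assume "j \<in> {j. Y a (s - of_nat j) b \<noteq> 0}"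
    then have "(\<Sum>k<K. \<psi> k (s - of_nat j - d k)) \<noteq> 0" using *(3) by simp
    then obtain k where "k < K" "\<psi> k (s - of_nat j - d k) \<noteq> 0"
      by (auto elim: sum.not_neutral_contains_not_neutral)
    then have "(s - d k) - of_nat j \<in> \<nat>"
      using *(2)[of k] by (auto simp: power_series_def algebra_simps)
    with \<open>k < K\<close> show "j \<in> (\<Union>k<K. {j. (s - d k) - of_nat j \<in> \<nat>})" by blast
  qed
  then show ?thesis by (rule finite_subset) (auto intro: finite_nat_shift)
qed

lemma Y_vac_not_nat: "n \<notin> \<nat> \<Longrightarrow> Y a n vac = 0"
  using Y_vac_power_series[of a] unfolding power_series_def by blast

text \<open>At the vacuum the term \<open>T vac\<close> drops out, so the commutator with
  \<open>T\<close> becomes a recursion for the Taylor coefficients; dividing by \<open>n + 1\<close>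
  is possible because \<open>emb\<close> is injective.\<close>

lemma Y_vac_Suc:
  "Y a (of_nat (Suc n)) vac = scale (inverse (emb (of_nat n + 1))) (T (Y a (of_nat n) vac))"
proof -
  have "(of_nat n + 1 :: complex) \<noteq> 0"
    by (metis of_nat_Suc of_nat_eq_0_iff add.commute nat.distinct(1))
  then have "emb (of_nat n + 1) \<noteq> 0" by (rule emb_nonzero)
  moreover have "T (Y a (of_nat n) vac) = scale (emb (of_nat n + 1)) (Y a (of_nat n + 1) vac)"
    using T_commutator[of a "of_nat n" vac] by (simp add: T_vac Y_0)
  ultimately show ?thesis by (simp add: add.commute)
qed

lemma \<Delta>_zero_right: "0 \<in> \<Delta> \<alpha> 0"
proof -
  obtain u where "\<Delta> \<alpha> 0 = {y. u - y \<in> \<int>}"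
    using complex_mod_int_cases[OF \<Delta>_coset[of \<alpha> 0]] by blast
  then have u: "u \<in> \<Delta> \<alpha> 0" by simp
  \<comment> \<open>Biadditivity at \<open>0 + 0\<close> makes the coset idempotent, so
    \<open>u\<close> and \<open>u + u\<close> differ by an integer and \<open>u\<close> itself is
    one.\<close>
  have "u + u \<in> \<Delta> \<alpha> 0 + \<Delta> \<alpha> 0" using u by (rule set_plus_intro) (rule u)
  then have "u + u \<in> \<Delta> \<alpha> 0" using \<Delta>_add_right[of \<alpha> 0 0] by simp
  then have "u - (u + u) \<in> \<int>" using complex_mod_int_eq[OF \<Delta>_coset u] by blast
  then have "u - 0 \<in> \<int>" by simp
  then show ?thesis using complex_mod_int_eq[OF \<Delta>_coset u] by blast
qed

end

subsection \<open>Monomials in the generators\<close>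

locale GVA_generators = GVA_charge_factor scale emb Y vac T \<Delta> \<eta> Vg
  for scale :: "'k::field \<Rightarrow> 'v::ab_group_add \<Rightarrow> 'v" and emb :: "complex \<Rightarrow> 'k"
    and Y :: "'v \<Rightarrow> ('v \<Rightarrow> 'v) fseries" and vac :: 'v and T :: "'v \<Rightarrow> 'v"
    and \<Delta> :: "'q::ab_group_add \<Rightarrow> 'q \<Rightarrow> complex set" and \<eta> Vg +
  fixes B :: "'b::linorder set" and \<iota> :: "'b \<Rightarrow> 'v" and \<N> :: "'b \<Rightarrow> 'b \<Rightarrow> complex" and \<chi> :: "'b \<Rightarrow> 'q"
  assumes \<iota>_degree: "b \<in> B \<Longrightarrow> \<iota> b \<in> Vg (\<chi> b)"
    and \<N>_sym: "a \<in> B \<Longrightarrow> b \<in> B \<Longrightarrow> \<N> a b = \<N> b a"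
    and \<N>_bound: "a \<in> B \<Longrightarrow> b \<in> B \<Longrightarrow>
      is_locality_bound scale emb \<Delta> (\<eta> (\<chi> a) (\<chi> b)) (\<chi> a) (\<chi> b) (Y (\<iota> a)) (Y (\<iota> b)) (\<N> a b)"
begin

definition charge :: "('b \<times> int) list \<Rightarrow> 'q"
  where "charge L = (\<Sum>(c, n)\<leftarrow>L. \<chi> c)"

text \<open>Blind to the exponents and to the order of the list, which is why rewriting an inner
  factor leaves the outer modes untouched.\<close>

definition shift :: "'b \<Rightarrow> ('b \<times> int) list \<Rightarrow> complex"
  where "shift b L = (\<Sum>(c, n)\<leftarrow>L. \<N> b c)"

text \<open>
  Lists are in reversed order: the head is the generator applied last. An entry \<open>(b, n)\<close> stands for
  \<open>(b, m)\<close> in \<^const>\<open>Psi\<close> with \<open>n = - m - 1\<close>, which turns the mode \<open>m + \<Sum> \<N>\<close> into the exponent \<open>n - \<Sum> \<N>\<close>.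
\<close>

fun monom_vec :: "('b \<times> int) list \<Rightarrow> 'v"
  where
    "monom_vec [] = vac"
  | "monom_vec ((b, n) # L) = Y (\<iota> b) (of_int n - shift b L) (monom_vec L)"

abbreviation over_B :: "('b \<times> int) list \<Rightarrow> bool"
  where "over_B L \<equiv> fst ` set L \<subseteq> B"

lemma shift_Nil [simp]: "shift b [] = 0"
  and shift_Cons [simp]: "shift b ((c, n) # L) = \<N> b c + shift b L"
  and shift_append [simp]: "shift b (K @ L) = shift b K + shift b L"
  by (simp_all add: shift_def)

lemma monom_vec_degree: "over_B L \<Longrightarrow> monom_vec L \<in> Vg (charge L)"
  by (induction L rule: monom_vec.induct) (auto simp: charge_def vac_degree intro!: Y_degree \<iota>_degree)

lemma shift_in_\<Delta>: "b \<in> B \<Longrightarrow> over_B L \<Longrightarrow> shift b L \<in> \<Delta> (\<chi> b) (charge L)"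
proof (induction L)
  case Nil
  then show ?case by (simp add: charge_def \<Delta>_zero_right)
next
  case (Cons x L)
  obtain c n where x: "x = (c, n)" by fastforce
  have "\<N> b c \<in> \<Delta> (\<chi> b) (\<chi> c)"
    using \<N>_bound[of b c] Cons.prems x unfolding is_locality_bound_def by auto
  moreover have "shift b L \<in> \<Delta> (\<chi> b) (charge L)" using Cons by auto
  ultimately have "\<N> b c + shift b L \<in> \<Delta> (\<chi> b) (\<chi> c + charge L)"
    unfolding \<Delta>_add_right by (rule set_plus_intro)
  then show ?case by (simp add: x charge_def)
qed

text \<open>A non-zero value makes \<open>e\<close> a natural number minus an element of a coset
  that \<open>shift b L\<close> represents. Hence arbitrary modes of generators create nothing
  beyond monomials with integer entries.\<close>

lemma Y_monom_vec_cases: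
  assumes "b \<in> B" "over_B L"
  shows "Y (\<iota> b) e (monom_vec L) = 0 \<or> (\<exists>n. Y (\<iota> b) e (monom_vec L) = monom_vec ((b, n) # L))"
proof (cases "Y (\<iota> b) e (monom_vec L) = 0")
  case False
  then obtain \<delta> where \<delta>: "\<delta> \<in> \<Delta> (\<chi> b) (charge L)" "e + \<delta> \<in> \<nat>"
    using Y_exponent[OF \<iota>_degree monom_vec_degree] assms by blast
  have \<delta>': "shift b L - \<delta> \<in> \<int>"
    using \<delta>(1) complex_mod_int_eq[OF \<Delta>_coset shift_in_\<Delta>[OF assms]] by blast
  have "(e + \<delta>) + (shift b L - \<delta>) \<in> \<int>"
    by (rule Ints_add[OF subsetD[OF Nats_subset_Ints \<delta>(2)] \<delta>'])
  then obtain n where "e + shift b L = of_int n" by (auto elim: Ints_cases)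
  then have "e = of_int n - shift b L" by (simp add: eq_diff_eq)
  then show ?thesis by auto
qed simp

text \<open>The outer modes are linear and see \<open>L\<close> only through its shifts, so a
  relation among inner monomials with equal shifts survives any outer factors.\<close>

lemma monom_vec_append_in_span:
  assumes "monom_vec L \<in> span (monom_vec ` X)"
    and "\<And>L' b. L' \<in> X \<Longrightarrow> shift b L' = shift b L"
  shows "monom_vec (R @ L) \<in> span (monom_vec ` (@) R ` X)"
proof (induction R)
  case Nil
  then show ?case using assms(1) by simp
next
  case (Cons x R)
  obtain b n where x: "x = (b, n)" by fastforce
  have "Y (\<iota> b) (of_int n - shift b (R @ L)) (monom_vec (R @ L)) \<in> span (monom_vec ` (@) (x # R) ` X)"
  proof (rule linear_span_into_span[OF Y_endo Cons.IH])
    fix y assume "y \<in> monom_vec ` (@) R ` X"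
    then obtain L' where L': "L' \<in> X" "y = monom_vec (R @ L')" by auto
    have "shift b (R @ L) = shift b (R @ L')"
      using assms(2)[OF L'(1)] by simp
    then have "Y (\<iota> b) (of_int n - shift b (R @ L)) y = monom_vec ((x # R) @ L')"
      by (simp add: L' x)
    then show "Y (\<iota> b) (of_int n - shift b (R @ L)) y \<in> span (monom_vec ` (@) (x # R) ` X)"
      using L'(1) by (intro span_base) auto
  qed
  then show ?case by (simp add: x)
qed

lemma monom_vec_append_0: "monom_vec L = 0 \<Longrightarrow> monom_vec (R @ L) = 0"
  by (induction R rule: monom_vec.induct) (auto simp: Y_0)

text \<open>The shift of \<open>a\<close> past \<open>b\<close> contains exactly the locality bound
  \<open>\<N> a b\<close>. Locality cancels it when \<open>a\<close> moves inwards, and by symmetry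
  the same number becomes the shift of the outer \<open>b\<close>, so the entries stay
  integral.\<close>

lemma monom_vec_exchange_head:
  assumes "a \<in> B" "b \<in> B" "over_B L"
  shows "monom_vec ((a, r) # (b, s) # L) \<in> span (monom_vec `
    ({(a, r + int j) # (b, s - int j) # L | j. j > 0} \<union> {(b, s + int j) # (a, r - int j) # L | j. True}))"
    (is "_ \<in> span (monom_vec ` (?X \<union> ?Z))")
proof -
  let ?r = "of_int r - shift a ((b, s) # L)" and ?s = "of_int s - shift b L"
  have "Y (\<iota> a) ?r (Y (\<iota> b) ?s (monom_vec L)) \<in> span (monom_vec ` (?X \<union> ?Z))"
  proof (rule locality_head_in_span[OF \<N>_bound[OF assms(1,2)] Y_endo])
    show "finite {j::nat. Y (\<iota> b) (?s - of_nat j) (monom_vec L) \<noteq> 0}"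
      using assms by (intro Y_truncation[OF \<iota>_degree monom_vec_degree])
    fix j :: nat
    show "Y (\<iota> a) (?r + of_nat j) (Y (\<iota> b) (?s - of_nat j) (monom_vec L)) \<in> span (monom_vec ` (?X \<union> ?Z))"
      if "j > 0"
    proof -
      have "Y (\<iota> a) (?r + of_nat j) (Y (\<iota> b) (?s - of_nat j) (monom_vec L)) =
          monom_vec ((a, r + int j) # (b, s - int j) # L)"
        by (simp add: algebra_simps)
      also have "\<dots> \<in> monom_vec ` (?X \<union> ?Z)" using that by blast
      finally show ?thesis by (rule span_base)
    qed
    have "Y (\<iota> b) (?s - \<N> a b + of_nat j) (Y (\<iota> a) (?r + \<N> a b - of_nat j) (monom_vec L)) =
        monom_vec ((b, s + int j) # (a, r - int j) # L)"
      using \<N>_sym[OF assms(1,2)] by (simp add: algebra_simps)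
    also have "\<dots> \<in> monom_vec ` (?X \<union> ?Z)" by blast
    finally show "Y (\<iota> b) (?s - \<N> a b + of_nat j) (Y (\<iota> a) (?r + \<N> a b - of_nat j) (monom_vec L)) \<in>
      span (monom_vec ` (?X \<union> ?Z))" by (rule span_base)
  qed
  then show ?thesis by simp
qed

lemma monom_vec_exchange:
  assumes "a \<in> B" "b \<in> B" "over_B L"
    and "\<And>j. j > 0 \<Longrightarrow> monom_vec (R @ (a, r + int j) # (b, s - int j) # L) \<in> span U"
    and "\<And>j. monom_vec (R @ (b, s + int j) # (a, r - int j) # L) \<in> span U"
  shows "monom_vec (R @ (a, r) # (b, s) # L) \<in> span U"
proof -
  let ?X = "{(a, r + int j) # (b, s - int j) # L | j. j > 0} \<union> {(b, s + int j) # (a, r - int j) # L | j. True}"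
  have "monom_vec (R @ (a, r) # (b, s) # L) \<in> span (monom_vec ` (@) R ` ?X)"
  proof (rule monom_vec_append_in_span)
    show "monom_vec ((a, r) # (b, s) # L) \<in> span (monom_vec ` ?X)"
      using assms(1-3) by (rule monom_vec_exchange_head)
    fix L' c assume "L' \<in> ?X"
    then show "shift c L' = shift c ((a, r) # (b, s) # L)" by (elim UnE CollectE exE) simp_all
  qed
  moreover have "span (monom_vec ` (@) R ` ?X) \<subseteq> span U"
  proof (rule span_minimal[OF _ subspace_span])
    show "monom_vec ` (@) R ` ?X \<subseteq> span U" using assms(4,5) by auto
  qed
  ultimately show ?thesis by blast
qed

subsection \<open>Vanishing\<close>

definition exponent_sum :: "('b \<times> int) list \<Rightarrow> int"
  where "exponent_sum L = (\<Sum>(c, n)\<leftarrow>L. n)"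

lemma exponent_sum_simps [simp]:
  "exponent_sum [] = 0" "exponent_sum ((c, n) # L) = n + exponent_sum L" "exponent_sum (K @ L) = exponent_sum K + exponent_sum L"
  by (simp_all add: exponent_sum_def)

text \<open>The sum of the exponent sums of all suffixes, hence of all inner factors of the monomial.\<close>

fun weight :: "('b \<times> int) list \<Rightarrow> int"
  where
    "weight [] = 0"
  | "weight (x # L) = exponent_sum (x # L) + weight L"

lemma weight_append: "weight (R @ L) = weight R + weight L + int (length R) * exponent_sum L"
proof (induction R)
  case (Cons x R)
  then show ?case by (cases x) (simp add: algebra_simps)
qed simp

text \<open>Both changes touch only the suffix that starts at the inner of the two factors: its
  first exponent \<open>s\<close> becomes \<open>s - j\<close>, or \<open>r - j\<close> after the
  swap.\<close>

lemma weight_exchange: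
  "weight (R @ (a, r + int j) # (b, s - int j) # L) = weight (R @ (a, r) # (b, s) # L) - int j"
  "weight (R @ (b, s + int j) # (a, r - int j) # L) = weight (R @ (a, r) # (b, s) # L) - (s - r + int j)"
  by (simp_all add: weight_append algebra_simps)

lemma weight_neg: "weight L < 0 \<Longrightarrow> \<exists>R K. L = R @ K \<and> exponent_sum K < 0"
proof (induction L)
  case (Cons x L)
  show ?case
  proof (cases "exponent_sum (x # L) < 0")
    case True
    then show ?thesis by (intro exI[of _ "[]"] exI[of _ "x # L"]) simp
  next
    case False
    then obtain R K where "L = R @ K" "exponent_sum K < 0" using Cons by auto
    then show ?thesis by (intro exI[of _ "x # R"] exI[of _ K]) simp
  qed
qed simp

lemma adjacent_descent:
  assumes "transp P" and "\<not> sorted_wrt P (rev L)"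
  shows "\<exists>R x y K. L = R @ x # y # K \<and> \<not> P y x"
  using assms(2)
proof (induction L)
  case (Cons x L)
  show ?case
  proof (cases "sorted_wrt P (rev L)")
    case True
    then obtain z where z: "z \<in> set L" "\<not> P z x"
      using Cons.prems by (auto simp: sorted_wrt_append)
    then obtain y K where L: "L = y # K" by (cases L) auto
    \<comment> \<open>Sortedness of the rest makes every entry \<open>z\<close> of \<open>L\<close>
      equal to \<open>y\<close> or related to it, so by transitivity a violation at \<open>z\<close>
      is already one at the neighbour \<open>y\<close>.\<close>
    have "\<not> P y x"
    proof
      assume "P y x"
      then have "P z x"
        using z True assms(1) unfolding L by (auto simp: sorted_wrt_append dest: transpD)
      with z(2) show False by contradiction
    qed
    then show ?thesis unfolding L by (intro exI[of _ "[]"]) auto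
  next
    case False
    then obtain R y z K where "L = R @ y # z # K" "\<not> P z y" using Cons.IH by blast
    then show ?thesis by (intro exI[of _ "x # R"] exI[of _ y] exI[of _ z] exI[of _ K]) simp
  qed
qed simp

lemma monom_vec_exponent_sum_neg: "over_B L \<Longrightarrow> exponent_sum L < 0 \<Longrightarrow> monom_vec L = 0"
proof (induction "length L" arbitrary: L rule: less_induct)
  case less
  define n where "n = length L"
  have shorter: "monom_vec K = 0" if "length K < n" "over_B K" "exponent_sum K < 0" for K
    using that unfolding n_def by (rule less.hyps)
  show ?case
    using n_def[symmetric] less.prems
  \<comment> \<open>For a non-empty list the measure is built from the weight of the tail. Exchanges
    fix the exponent sum and lower the weight; a negative tail weight yields a shorter factor with
    negative exponent sum, which vanishes by the outer induction.\<close>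
  proof (induction "nat (weight L - exponent_sum L + 1)" arbitrary: L rule: less_induct)
    case (less K)
    show ?case
    proof (cases "sorted_wrt (\<lambda>x y. snd x \<le> snd y) (rev K)")
      case True
      have "K \<noteq> []" using less.prems by auto
      then obtain R x where K: "K = R @ [x]" by (metis rev_exhaust)
      obtain b n where x: "x = (b, n)" by fastforce
      \<comment> \<open>The innermost exponent is the smallest one, so it is negative when the sum
        is, and such a coefficient vanishes at the vacuum.\<close>
      have "n < 0"
      proof (rule ccontr)
        assume "\<not> n < 0"
        then have "\<forall>y\<in>set K. 0 \<le> snd y" using True by (auto simp: K x)
        then have "0 \<le> exponent_sum K"
          unfolding exponent_sum_def by (intro sum_list_nonneg) auto
        with less.prems show False by simp
      qed
      then have "of_int n \<notin> (\<nat> :: complex set)"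
        by (metis Nats_cases of_int_eq_iff of_int_of_nat_eq of_nat_less_0_iff)
      then have "monom_vec [x] = 0" by (simp add: x Y_vac_not_nat)
      then show ?thesis unfolding K by (rule monom_vec_append_0)
    next
      case False
      have "transp (\<lambda>x y :: 'b \<times> int. snd x \<le> snd y)" by (auto intro: transpI)
      from adjacent_descent[OF this False]
      obtain R a r b s J where K: "K = R @ (a, r) # (b, s) # J" "r < s" by force
      have "K \<noteq> []" using K(1) by simp
      show ?thesis
      proof (cases "weight (tl K) < 0")
        case True
        then obtain R' K' where *: "tl K = R' @ K'" "exponent_sum K' < 0" using weight_neg by blast
        have K': "K = (hd K # R') @ K'"
          unfolding append_Cons *(1)[symmetric] using \<open>K \<noteq> []\<close> by simp
        have "length K' < length K" using arg_cong[OF K', of length] by simp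
        then have "length K' < n" using less.prems by simp
        moreover have "set K' \<subseteq> set K" using arg_cong[OF K', of set] by auto
        then have "over_B K'" using less.prems by blast
        ultimately have "monom_vec K' = 0" using *(2) shorter by blast
        then show ?thesis by (subst K') (rule monom_vec_append_0)
      next
        case nonneg: False
        have "weight K = exponent_sum K + weight (tl K)"
          using \<open>K \<noteq> []\<close> by (metis list.collapse weight.simps(2))
        then have pos: "weight K - exponent_sum K \<ge> 0" using nonneg by simp
        \<comment> \<open>\<open>span {}\<close> contains only 0, which turns the exchange rule into
          a rule for vanishing.\<close>
        have smaller: "monom_vec M \<in> span {}"
          if "weight M < weight K" "exponent_sum M = exponent_sum K" "length M = length K" "over_B M" for M
          using less.hyps[of M] that pos less.prems by (simp add: span_zero)
        have "monom_vec K \<in> span {}"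
          unfolding K(1)
        proof (rule monom_vec_exchange)
          show "a \<in> B" "b \<in> B" "over_B J" using less.prems K by auto
          show "monom_vec (R @ (a, r + int j) # (b, s - int j) # J) \<in> span {}" if "j > 0" for j
            using that less.prems by (intro smaller) (auto simp: K(1) weight_exchange(1))
          show "monom_vec (R @ (b, s + int j) # (a, r - int j) # J) \<in> span {}" for j
            using K(2) less.prems by (intro smaller) (auto simp: K(1) weight_exchange(2))
        qed
        then show ?thesis by simp
      qed
    qed
  qed
qed

lemma monom_vec_weight_neg:
  assumes "over_B L" "weight L < 0"
  shows "monom_vec L = 0"
proof -
  obtain R K where L: "L = R @ K" "exponent_sum K < 0" using weight_neg[OF assms(2)] by blast
  then have "monom_vec K = 0" using assms(1) by (intro monom_vec_exponent_sum_neg) auto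
  then show ?thesis unfolding L(1) by (rule monom_vec_append_0)
qed

subsection \<open>Non-negative exponents\<close>

lemma monom_vec_Cons_in_span:
  assumes "monom_vec L \<in> span (monom_vec ` X)"
    and "\<And>L'. L' \<in> X \<Longrightarrow> map fst L' = map fst L"
    and "\<And>L'. L' \<in> X \<Longrightarrow> monom_vec (x # L') \<in> span U"
  shows "monom_vec (x # L) \<in> span U"
proof -
  have shift: "shift b L' = shift b L" if "map fst L' = map fst L" for L' b
  proof -
    have eq: "shift b K = (\<Sum>c\<leftarrow>map fst K. \<N> b c)" for K
      by (induction K) auto
    show ?thesis using that by (simp only: eq)
  qed
  have "monom_vec ([x] @ L) \<in> span (monom_vec ` (@) [x] ` X)"
    using assms(1) by (rule monom_vec_append_in_span) (use assms(2) shift in blast)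
  moreover have "span (monom_vec ` (@) [x] ` X) \<subseteq> span U"
  proof (rule span_minimal[OF _ subspace_span])
    show "monom_vec ` (@) [x] ` X \<subseteq> span U" using assms(3) by auto
  qed
  ultimately show ?thesis by auto
qed

lemma map_fst_over_B: "map fst L' = map fst L \<Longrightarrow> over_B L \<Longrightarrow> over_B L'"
  by (metis list.set_map)

text \<open>The bounds on exponent sum and tail weight keep the weight of the whole from growing.
  The recursion is on the length: \<open>a\<close> is corrected behind its neighbour
  \<open>b\<close>, where fewer factors lie inside.\<close>

lemma monom_vec_head_nonneg:
  assumes "a \<in> B" "over_B L"
  shows "monom_vec ((a, r) # L) \<in> span (monom_vec ` {(a, r') # L' | r' L'.
    r' \<ge> 0 \<and> map fst L' = map fst L \<and> r' + exponent_sum L' = r + exponent_sum L \<and> weight L' \<le> weight L})"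
  using assms(2)
proof (induction "length L" arbitrary: L r rule: less_induct)
  case (less K)
  show ?case
  proof (cases K)
    case Nil
    show ?thesis
    proof (cases "r < 0")
      case True
      then have "monom_vec [(a, r)] = 0" using assms(1) by (intro monom_vec_exponent_sum_neg) auto
      then show ?thesis by (simp add: Nil span_zero)
    qed (auto simp: Nil intro!: span_base)
  next
    case (Cons x L)
    obtain b s where x: "x = (b, s)" by fastforce
    have b: "b \<in> B" and L: "over_B L" using less.prems Cons x by auto
    \<comment> \<open>Stated relative to the fixed \<open>L\<close>, since the tail changes while
      exponents are moved.\<close>
    have IH: "monom_vec ((a, r') # L') \<in> span (monom_vec ` {(a, r'') # L'' | r'' L''.
        r'' \<ge> 0 \<and> map fst L'' = map fst L \<and> r'' + exponent_sum L'' = r' + exponent_sum L' \<and> weight L'' \<le> weight L})"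
        (is "_ \<in> span (monom_vec ` ?R)")
      if "map fst L' = map fst L" "weight L' \<le> weight L" for r' L'
    proof -
      have "length L' < length K" using arg_cong[OF that(1), of length] Cons by simp
      then have "monom_vec ((a, r') # L') \<in> span (monom_vec ` {(a, r'') # L'' | r'' L''.
          r'' \<ge> 0 \<and> map fst L'' = map fst L' \<and> r'' + exponent_sum L'' = r' + exponent_sum L' \<and> weight L'' \<le> weight L'})"
          (is "_ \<in> span (monom_vec ` ?R')")
        using map_fst_over_B[OF that(1) L] by (rule less.hyps)
      moreover have "?R' \<subseteq> ?R" using that by auto
      ultimately show ?thesis by (meson image_mono span_mono subsetD)
    qed
    define D where "D = r + s + exponent_sum L"
    define X where "X = {(a, r') # (b, s') # L' | r' s' L'.
      r' \<ge> 0 \<and> map fst L' = map fst L \<and> r' + s' + exponent_sum L' = D \<and> weight L' \<le> weight L}"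
    \<comment> \<open>Moving \<open>a\<close> inwards past \<open>b\<close>, making its exponent non-negative there and moving it back only
      leaves terms where the exponent sum up to \<open>a\<close> has dropped; it cannot become negative.\<close>
    have swapped: "monom_vec ((b, s') # (a, r') # L') \<in> span (monom_vec ` X)"
      if "map fst L' = map fst L" "weight L' \<le> weight L" "r' + s' + exponent_sum L' = D" for s' r' L'
      using that
    proof (induction "nat (r' + exponent_sum L' + 1)" arbitrary: r' s' L' rule: less_induct)
      case less
      have L': "over_B L'" using map_fst_over_B[OF less.prems(1) L] .
      show ?case
      proof (cases "r' + exponent_sum L' < 0")
        case True
        then have "monom_vec ((a, r') # L') = 0" using L' assms(1) by (intro monom_vec_exponent_sum_neg) auto
        then show ?thesis by (simp add: Y_0 span_zero)
      next
        case nonneg: False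
        have "monom_vec ((a, r') # L') \<in> span (monom_vec ` {(a, r'') # L'' | r'' L''.
            r'' \<ge> 0 \<and> map fst L'' = map fst L \<and> r'' + exponent_sum L'' = r' + exponent_sum L' \<and> weight L'' \<le> weight L})"
          using less.prems(1,2) by (rule IH)
        then show ?thesis
        proof (rule monom_vec_Cons_in_span)
          fix K assume "K \<in> {(a, r'') # L'' | r'' L''.
            r'' \<ge> 0 \<and> map fst L'' = map fst L \<and> r'' + exponent_sum L'' = r' + exponent_sum L' \<and> weight L'' \<le> weight L}"
          then obtain r'' L'' where K: "K = (a, r'') # L''" "r'' \<ge> 0" "map fst L'' = map fst L"
            "r'' + exponent_sum L'' = r' + exponent_sum L'" "weight L'' \<le> weight L" by blast
          show "map fst K = map fst ((a, r') # L')" using K less.prems by simp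
          have "monom_vec ([] @ (b, s') # (a, r'') # L'') \<in> span (monom_vec ` X)"
          proof (rule monom_vec_exchange)
            show "b \<in> B" "a \<in> B" by fact+
            show "over_B L''" using map_fst_over_B[OF K(3) L] .
            show "monom_vec ([] @ (b, s' + int j) # (a, r'' - int j) # L'') \<in> span (monom_vec ` X)" if "j > 0" for j
              unfolding append_Nil using that K less.prems nonneg by (intro less.hyps) auto
            show "monom_vec ([] @ (a, r'' + int j) # (b, s' - int j) # L'') \<in> span (monom_vec ` X)" for j
            proof (rule span_base, rule imageI)
              show "[] @ (a, r'' + int j) # (b, s' - int j) # L'' \<in> X"
                unfolding X_def using K less.prems by auto
            qed
          qed
          then show "monom_vec ((b, s') # K) \<in> span (monom_vec ` X)" by (simp add: K(1))
        qed
      qed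
    qed
    \<comment> \<open>With \<open>a\<close> outside, the corrections move exponent from
      \<open>b\<close> to \<open>a\<close>; this ends at the latest when the exponent sum inside
      \<open>a\<close> is negative and the inner factor vanishes.\<close>
    have in_X: "monom_vec ((a, r') # (b, s') # L) \<in> span (monom_vec ` X)" if "r' + s' + exponent_sum L = D" for r' s'
      using that
    proof (induction "nat (s' + exponent_sum L + 1)" arbitrary: r' s' rule: less_induct)
      case less
      show ?case
      proof (cases "r' \<ge> 0")
        case True
        then have "(a, r') # (b, s') # L \<in> X" unfolding X_def using less.prems by auto
        then show ?thesis by (intro span_base imageI)
      next
        case r': False
        show ?thesis
        proof (cases "s' + exponent_sum L < 0")
          case True
          then have "monom_vec ((b, s') # L) = 0" using L b by (intro monom_vec_exponent_sum_neg) auto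
          then show ?thesis by (simp add: Y_0 span_zero)
        next
          case False
          have "monom_vec ([] @ (a, r') # (b, s') # L) \<in> span (monom_vec ` X)"
          proof (rule monom_vec_exchange)
            show "a \<in> B" "b \<in> B" "over_B L" by fact+
            show "monom_vec ([] @ (a, r' + int j) # (b, s' - int j) # L) \<in> span (monom_vec ` X)" if "j > 0" for j
              unfolding append_Nil using that less.prems False by (intro less.hyps) auto
            show "monom_vec ([] @ (b, s' + int j) # (a, r' - int j) # L) \<in> span (monom_vec ` X)" for j
              unfolding append_Nil using less.prems by (intro swapped) auto
          qed
          then show ?thesis by simp
        qed
      qed
    qed
    show ?thesis
    proof (cases "r \<ge> 0")
      case True
      then show ?thesis unfolding Cons by (intro span_base imageI) auto
    next
      case False
      have "monom_vec ((a, r) # x # L) \<in> span (monom_vec ` X)"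
        unfolding x by (rule in_X) (simp add: D_def)
      \<comment> \<open>As \<open>r < 0 \<le> r'\<close> and the total is fixed, the exponent sum of
        the tail drops; so the tail weight is bounded although \<open>X\<close> bounds only that of
        \<open>L'\<close>.\<close>
      moreover have "X \<subseteq> {(a, r') # L' | r' L'. r' \<ge> 0 \<and> map fst L' = map fst (x # L) \<and>
          r' + exponent_sum L' = r + exponent_sum (x # L) \<and> weight L' \<le> weight (x # L)}"
        unfolding X_def using False by (auto simp: x D_def)
      ultimately show ?thesis unfolding Cons by (meson image_mono span_mono subsetD)
    qed
  qed
qed

text \<open>The head is corrected first, then the resulting tails, which are shorter and have the
  same generators as before. Correcting a tail keeps its exponent sum, hence the total, and does not
  raise its weight.\<close>

lemma monom_vec_nonneg:
  assumes "over_B L"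
  shows "monom_vec L \<in> span (monom_vec ` {L'. map fst L' = map fst L \<and>
    (\<forall>x\<in>set L'. snd x \<ge> 0) \<and> exponent_sum L' = exponent_sum L \<and> weight L' \<le> weight L})"
  using assms
proof (induction "length L" arbitrary: L rule: less_induct)
  case less
  show ?case
  proof (cases L)
    case Nil
    then show ?thesis by (auto intro!: span_base)
  next
    case (Cons x K)
    obtain a r where x: "x = (a, r)" by fastforce
    let ?S = "{L'. map fst L' = map fst L \<and>
      (\<forall>x\<in>set L'. snd x \<ge> 0) \<and> exponent_sum L' = exponent_sum L \<and> weight L' \<le> weight L}"
    let ?X = "{(a, r') # L' | r' L'.
      r' \<ge> 0 \<and> map fst L' = map fst K \<and> r' + exponent_sum L' = r + exponent_sum K \<and> weight L' \<le> weight K}"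
    have aK: "a \<in> B" "over_B K" using less.prems Cons x by auto
    have "monom_vec ` ?X \<subseteq> span (monom_vec ` ?S)"
    proof clarify
      fix r' K' assume *: "r' \<ge> 0" "map fst K' = map fst K" "r' + exponent_sum K' = r + exponent_sum K" "weight K' \<le> weight K"
      have "length K' < length L" using arg_cong[OF *(2), of length] Cons by simp
      then have "monom_vec K' \<in> span (monom_vec ` {L'. map fst L' = map fst K' \<and>
          (\<forall>x\<in>set L'. snd x \<ge> 0) \<and> exponent_sum L' = exponent_sum K' \<and> weight L' \<le> weight K'})"
        using map_fst_over_B[OF *(2) aK(2)] by (rule less.hyps)
      then show "monom_vec ((a, r') # K') \<in> span (monom_vec ` ?S)"
      proof (rule monom_vec_Cons_in_span)
        fix L' assume L': "L' \<in> {L'. map fst L' = map fst K' \<and>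
          (\<forall>x\<in>set L'. snd x \<ge> 0) \<and> exponent_sum L' = exponent_sum K' \<and> weight L' \<le> weight K'}"
        then show "map fst L' = map fst K'" by blast
        have "(a, r') # L' \<in> ?S" using L' * by (auto simp: Cons x)
        then show "monom_vec ((a, r') # L') \<in> span (monom_vec ` ?S)" by (intro span_base imageI)
      qed
    qed
    then have "span (monom_vec ` ?X) \<subseteq> span (monom_vec ` ?S)"
      by (rule span_minimal) (rule subspace_span)
    then show ?thesis using monom_vec_head_nonneg[OF aK] unfolding Cons x by blast
  qed
qed

subsection \<open>Ordering\<close>

text \<open>The assumption covers all exponents because the terms with \<open>a\<close> and
  \<open>b\<close> swapped may have larger weight. Corrections in the old order have smaller weight,
  and negative weight means zero, so the recursion ends.\<close>

lemma monom_vec_swap_generators: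
  assumes "set (xs @ a # b # ys) \<subseteq> B"
    and "\<And>L. map fst L = xs @ b # a # ys \<Longrightarrow> monom_vec L \<in> span U"
    and "map fst L = xs @ a # b # ys"
  shows "monom_vec L \<in> span U"
  using assms(3)
proof (induction "nat (weight L + 1)" arbitrary: L rule: less_induct)
  case less
  obtain R r s K where L: "L = R @ (a, r) # (b, s) # K" and R: "map fst R = xs" and K: "map fst K = ys"
    using less.prems by (auto simp: map_eq_append_conv map_eq_Cons_conv)
  have L_B: "over_B L" using less.prems assms(1) by (metis list.set_map)
  show ?case
  proof (cases "weight L < 0")
    case True
    then show ?thesis using L_B by (simp add: monom_vec_weight_neg span_zero)
  next
    case False
    show ?thesis
      unfolding L
    proof (rule monom_vec_exchange)
      show "a \<in> B" "b \<in> B" "over_B K" using L_B L by auto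
      show "monom_vec (R @ (a, r + int j) # (b, s - int j) # K) \<in> span U" if "j > 0" for j
        using that False by (intro less.hyps) (auto simp: L R K weight_exchange(1))
      show "monom_vec (R @ (b, s + int j) # (a, r - int j) # K) \<in> span U" for j
        by (intro assms(2)) (simp add: R K)
    qed
  qed
qed

lemma monom_vec_sort_generators:
  assumes sorted: "\<And>K. over_B K \<Longrightarrow> sorted (rev (map fst K)) \<Longrightarrow> monom_vec K \<in> span U"
    and L: "over_B L"
  shows "monom_vec L \<in> span U"
proof -
  \<comment> \<open>\<open>P\<close> speaks about words of generators, innermost first, with all
    exponents at once. Insertion sort is then traced backwards from the sorted word by adjacent
    swaps.\<close>
  define P where "P as \<longleftrightarrow> (\<forall>K. map fst K = rev as \<longrightarrow> monom_vec K \<in> span U)" for as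
  have swap: "P (xs @ x # y # ys)" if "P (xs @ y # x # ys)" "set (xs @ x # y # ys) \<subseteq> B" for xs x y ys
    using that monom_vec_swap_generators[of "rev ys" y x "rev xs" U] unfolding P_def by simp
  have insert: "P (xs @ x # ys)" if "P (xs @ insort x ys)" "set (xs @ x # ys) \<subseteq> B" for xs x ys
    using that
  proof (induction ys arbitrary: xs)
    case (Cons y ys)
    show ?case
    proof (cases "x \<le> y")
      case False
      then have "P ((xs @ [y]) @ insort x ys)" using Cons.prems(1) by simp
      then have "P ((xs @ [y]) @ x # ys)" by (rule Cons.IH) (use Cons.prems(2) in auto)
      then have "P (xs @ y # x # ys)" by simp
      then show ?thesis using Cons.prems(2) by (rule swap)
    qed (use Cons.prems in simp)
  qed simp
  have sort: "P (xs @ ys)" if "P (xs @ sort ys)" "set (xs @ ys) \<subseteq> B" for xs ys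
    using that
  proof (induction ys arbitrary: xs)
    case (Cons y ys)
    have "P (xs @ insort y (sort ys))" using Cons.prems(1) by simp
    then have "P (xs @ y # sort ys)" by (rule insert) (use Cons.prems(2) in simp)
    then have "P ((xs @ [y]) @ sort ys)" by simp
    then have "P ((xs @ [y]) @ ys)" by (rule Cons.IH) (use Cons.prems(2) in simp)
    then show ?case by simp
  qed simp
  have B: "set ([] @ rev (map fst L)) \<subseteq> B" using L by simp
  have "P ([] @ sort (rev (map fst L)))"
    unfolding P_def
  proof (intro allI impI)
    fix K :: "('b \<times> int) list" assume K: "map fst K = rev ([] @ sort (rev (map fst L)))"
    have "over_B K" using arg_cong[OF K, of set] L by simp
    moreover have "sorted (rev (map fst K))" unfolding K by simp
    ultimately show "monom_vec K \<in> span U" by (rule sorted)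
  qed
  then have "P ([] @ rev (map fst L))" using B by (rule sort)
  then show ?thesis unfolding P_def by simp
qed

text \<open>The condition on ordered monomials in terms of \<open>n = - m - 1\<close>: weakly
  decreasing \<open>m\<close> among equal generators means weakly increasing
  \<open>n\<close>.\<close>

definition lex_le :: "'b \<times> int \<Rightarrow> 'b \<times> int \<Rightarrow> bool"
  where "lex_le x y \<longleftrightarrow> fst x \<le> fst y \<and> (fst x = fst y \<longrightarrow> snd x \<le> snd y)"

definition normal :: "('b \<times> int) list \<Rightarrow> bool"
  where "normal L \<longleftrightarrow> over_B L \<and> (\<forall>x\<in>set L. snd x \<ge> 0) \<and> sorted_wrt lex_le (rev L)"

lemma transp_lex_le: "transp lex_le"
  by (rule transpI) (auto simp: lex_le_def)

text \<open>Sorted generators leave descents only between equal generators, where the exchange keeps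
  the word of generators and lowers the weight in both families of terms.\<close>

lemma monom_vec_sorted_generators:
  assumes "over_B L" "sorted (rev (map fst L))"
  shows "monom_vec L \<in> span (monom_vec ` Collect normal)"
  using assms
proof (induction "nat (weight L + 1)" arbitrary: L rule: less_induct)
  case less
  show ?case
  proof (cases "weight L < 0")
    case True
    then show ?thesis using less.prems by (simp add: monom_vec_weight_neg span_zero)
  next
    case False
    \<comment> \<open>An exchange may create negative exponents; they are removed anew in each
      round, which does not raise the weight.\<close>
    let ?X = "{K. map fst K = map fst L \<and> (\<forall>x\<in>set K. snd x \<ge> 0) \<and> exponent_sum K = exponent_sum L \<and> weight K \<le> weight L}"
    have "monom_vec ` ?X \<subseteq> span (monom_vec ` Collect normal)"
    proof clarify
      fix K assume K: "map fst K = map fst L" "\<forall>x\<in>set K. snd x \<ge> 0" "weight K \<le> weight L"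
      have K_B: "over_B K" using K(1) less.prems(1) by (rule map_fst_over_B)
      show "monom_vec K \<in> span (monom_vec ` Collect normal)"
      proof (cases "sorted_wrt lex_le (rev K)")
        case True
        then have "normal K" using K K_B by (auto simp: normal_def)
        then show ?thesis by (intro span_base imageI) simp
      next
        case unsorted: False
        from adjacent_descent[OF transp_lex_le this]
        obtain R a r b s J where K_eq: "K = R @ (a, r) # (b, s) # J" and not_le: "\<not> lex_le (b, s) (a, r)"
          by force
        have "sorted (rev (map fst K))" using K(1) less.prems(2) by simp
        then have "b \<le> a" by (simp add: K_eq sorted_append)
        with not_le have ab: "b = a" and rs: "r < s" by (auto simp: lex_le_def)
        have step: "monom_vec M \<in> span (monom_vec ` Collect normal)"
          if "map fst M = map fst K" "weight M < weight K" for M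
        proof (rule less.hyps)
          show "nat (weight M + 1) < nat (weight L + 1)" using that K(3) False by simp
          show "over_B M" using that(1) K_B by (rule map_fst_over_B)
          show "sorted (rev (map fst M))" using that(1) K(1) less.prems(2) by simp
        qed
        show ?thesis
          unfolding K_eq
        proof (rule monom_vec_exchange)
          show "a \<in> B" "b \<in> B" "over_B J" using K_B K_eq by auto
          show "monom_vec (R @ (a, r + int j) # (b, s - int j) # J) \<in> span (monom_vec ` Collect normal)"
            if "j > 0" for j
            using that by (intro step) (auto simp: K_eq weight_exchange(1))
          show "monom_vec (R @ (b, s + int j) # (a, r - int j) # J) \<in> span (monom_vec ` Collect normal)" for j
          proof (rule step)
            show "weight (R @ (b, s + int j) # (a, r - int j) # J) < weight K"
              unfolding K_eq weight_exchange(2) using rs by simp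
          qed (simp add: K_eq ab)
        qed
      qed
    qed
    then have "span (monom_vec ` ?X) \<subseteq> span (monom_vec ` Collect normal)"
      by (rule span_minimal) (rule subspace_span)
    then show ?thesis using monom_vec_nonneg[OF less.prems(1)] by blast
  qed
qed

lemma span_normal: "span (monom_vec ` {L. over_B L}) \<subseteq> span (monom_vec ` Collect normal)"
proof (rule span_minimal[OF _ subspace_span])
  show "monom_vec ` {L. over_B L} \<subseteq> span (monom_vec ` Collect normal)"
    using monom_vec_sort_generators[OF monom_vec_sorted_generators] by blast
qed

section \<open>Normal lists as ordered monomials\<close>

lemma Psi_eq_monom_vec:
  "Psi Y vac \<iota> \<N> a m k = monom_vec (rev (map (\<lambda>j. (a j, - m j - 1)) [0..<k]))"
proof (induction k)
  case (Suc k)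
  have "shift b (rev (map (\<lambda>j. (a j, - m j - 1)) [0..<k])) = (\<Sum>j<k. \<N> b (a j))" for b
    by (induction k) simp_all
  then show ?case using Suc by (simp add: mode_def algebra_simps)
qed simp

lemma normal_ordered_monomial:
  assumes "normal L"
  shows "monom_vec L \<in> ordered_monomials Y vac B \<iota> \<N>"
proof -
  define a m where "a j = fst (rev L ! j)" and "m j = - snd (rev L ! j) - 1" for j
  have mem: "rev L ! j \<in> set L" if "j < length L" for j
    using that by (metis length_rev nth_mem set_rev)
  have "map (\<lambda>j. (a j, - m j - 1)) [0..<length L] = rev L"
    by (rule nth_equalityI) (simp_all add: a_def m_def)
  then have "monom_vec L = Psi Y vac \<iota> \<N> a m (length L)"
    by (simp add: Psi_eq_monom_vec)
  moreover have "\<forall>j<length L. a j \<in> B \<and> m j < 0"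
    using assms mem by (force simp: normal_def a_def m_def)
  moreover have "\<forall>j<length L. \<forall>i<j. a i \<le> a j \<and> (a i = a j \<longrightarrow> m i \<ge> m j)"
  proof (intro allI impI)
    fix i j assume "j < length L" "i < j"
    then have "lex_le (rev L ! i) (rev L ! j)"
      using assms by (simp add: normal_def sorted_wrt_iff_nth_less)
    then show "a i \<le> a j \<and> (a i = a j \<longrightarrow> m i \<ge> m j)"
      unfolding lex_le_def a_def m_def by linarith
  qed
  ultimately show ?thesis unfolding ordered_monomials_def by blast
qed

subsection \<open>Generation\<close>

abbreviation (input) monomial_span :: "'v set"
  where "monomial_span \<equiv> span (monom_vec ` {L. over_B L})"

lemma Y_generator_monomial_span:
  assumes "b \<in> B" "v \<in> monomial_span"
  shows "Y (\<iota> b) e v \<in> monomial_span"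
  using Y_endo assms(2)
proof (rule linear_span_into_span)
  fix y assume "y \<in> monom_vec ` {L. over_B L}"
  then obtain L where L: "over_B L" "y = monom_vec L" by blast
  from Y_monom_vec_cases[OF assms(1) L(1), of e] show "Y (\<iota> b) e y \<in> monomial_span"
  proof
    assume "Y (\<iota> b) e (monom_vec L) = 0"
    then show ?thesis by (simp add: L(2) span_zero)
  next
    assume "\<exists>n. Y (\<iota> b) e (monom_vec L) = monom_vec ((b, n) # L)"
    then obtain n where "Y (\<iota> b) e y = monom_vec ((b, n) # L)" using L(2) by blast
    moreover have "(b, n) # L \<in> {L. over_B L}" using L(1) assms(1) by simp
    ultimately show ?thesis by (metis imageI span_base)
  qed
qed

lemma T_monomial_span:
  assumes "v \<in> monomial_span"
  shows "T v \<in> monomial_span"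
  using T_linear assms
proof (rule linear_span_into_span)
  fix y assume "y \<in> monom_vec ` {L. over_B L}"
  then obtain L where "over_B L" "y = monom_vec L" by blast
  then show "T y \<in> monomial_span"
  proof (induction L arbitrary: y)
    case Nil
    then show ?case by (simp add: T_vac span_zero)
  next
    case (Cons x L)
    obtain b n where x: "x = (b, n)" by fastforce
    have b: "b \<in> B" and L: "over_B L" using Cons.prems x by auto
    let ?e = "of_int n - shift b L"
    have "T y = Y (\<iota> b) ?e (T (monom_vec L)) + scale (emb (?e + 1)) (Y (\<iota> b) (?e + 1) (monom_vec L))"
      using T_commutator[of "\<iota> b" ?e "monom_vec L"] by (simp add: Cons.prems x diff_eq_eq add.commute)
    also have "\<dots> \<in> monomial_span"
      using Cons.IH[OF L refl] L
      by (intro span_add span_scale Y_generator_monomial_span b) (auto intro: span_base)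
    finally show ?case .
  qed
qed

lemma Y_vac_monomial_span:
  assumes "u \<in> monomial_span"
  shows "Y u n vac \<in> monomial_span"
proof (cases "n \<in> \<nat>")
  case True
  then obtain k where n: "n = of_nat k" by (auto elim: Nats_cases)
  have "Y u (of_nat k) vac \<in> monomial_span"
  proof (induction k)
    case 0
    show ?case using assms by (simp add: Y_vac_at_0)
  next
    case (Suc k)
    then show ?case unfolding Y_vac_Suc by (intro span_scale T_monomial_span)
  qed
  then show ?thesis by (simp add: n)
next
  case False
  then show ?thesis by (simp add: Y_vac_not_nat span_zero)
qed

lemma Y_homogeneous_monomial_span:
  assumes u: "u \<in> monomial_span" "u \<in> Vg \<alpha>" and "over_B L"
  shows "Y u n (monom_vec L) \<in> monomial_span"
  using assms(3)
proof (induction L arbitrary: n)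
  case Nil
  then show ?case using u(1) by (simp add: Y_vac_monomial_span)
next
  case (Cons x L)
  obtain b m where x: "x = (b, m)" by fastforce
  have b: "b \<in> B" and L: "over_B L" using Cons.prems x by auto
  let ?c = "monom_vec L"
  let ?e = "of_int m - shift b L"
  have c: "?c \<in> Vg (charge L)" using L by (rule monom_vec_degree)
  have fin: "finite {j::nat. Y (\<iota> b) (e - of_nat j) ?c \<noteq> 0}" for e
    using \<iota>_degree[OF b] c by (rule Y_truncation)
  obtain N where N: "is_locality_bound scale emb \<Delta> (\<eta> \<alpha> (\<chi> b)) \<alpha> (\<chi> b) (Y u) (Y (\<iota> b)) N"
    using Y_local[OF u(2) \<iota>_degree[OF b]] by blast
  obtain K where K: "\<And>j. j \<ge> K \<Longrightarrow> Y (\<iota> b) (?e - of_nat j) ?c = 0"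
    using fin[of ?e] unfolding finite_nat_set_iff_bounded by (metis (mono_tags, lifting) leD mem_Collect_eq)
  \<comment> \<open>Descending induction on \<open>j\<close>, for all \<open>n\<close> at once:
    locality leads to larger \<open>j\<close>, where the inner vector vanishes from \<open>K\<close>
    on, and to \<open>u\<close> acting on the shorter monomial \<open>?c\<close>.\<close>
  have "Y u n (Y (\<iota> b) (?e - of_nat j) ?c) \<in> monomial_span" for n and j :: nat
  proof (induction "K - j" arbitrary: n j rule: less_induct)
    case less
    show ?case
    proof (cases "j \<ge> K")
      case True
      then show ?thesis by (simp add: K Y_0 span_zero)
    next
      case False
      show ?thesis
        using N Y_endo fin
      proof (rule locality_head_in_span)
        fix i :: nat
        show "Y u (n + of_nat i) (Y (\<iota> b) (?e - of_nat j - of_nat i) ?c) \<in> monomial_span" if "i > 0"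
          using less.hyps[of "j + i" "n + of_nat i"] that False by (simp add: diff_diff_eq add.assoc)
        show "Y (\<iota> b) (?e - of_nat j - N + of_nat i) (Y u (n + N - of_nat i) ?c) \<in> monomial_span"
          by (intro Y_generator_monomial_span b Cons.IH L)
      qed
    qed
  qed
  from this[of n 0] show ?case by (simp add: x)
qed

text \<open>Bilinearity reduces the claim to monomials, which are homogeneous by
  \<open>monom_vec_degree\<close>.\<close>

lemma Y_monomial_span:
  assumes "u \<in> monomial_span" "v \<in> monomial_span"
  shows "Y u n v \<in> monomial_span"
  using Y_linear assms(1)
proof (rule linear_span_into_span)
  fix y assume "y \<in> monom_vec ` {L. over_B L}"
  then have y: "y \<in> monomial_span" "\<exists>\<alpha>. y \<in> Vg \<alpha>"
    by (auto intro: span_base monom_vec_degree)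
  show "Y y n v \<in> monomial_span"
    using Y_endo assms(2)
    by (rule linear_span_into_span) (use y Y_homogeneous_monomial_span in blast)
qed

lemma monomials_span:
  assumes "generates scale Y vac T (\<iota> ` B)"
  shows "monomial_span = UNIV"
proof -
  have vac: "vac \<in> monomial_span"
    by (metis (mono_tags, lifting) empty_subsetI image_empty image_eqI list.set(1) mem_Collect_eq monom_vec.simps(1) span_base)
  have "insert vac (\<iota> ` B) \<subseteq> monomial_span"
    using vac Y_generator_monomial_span[OF _ vac, of _ 0] by (auto simp: Y_vac_at_0)
  moreover have "subspace monomial_span \<and> T ` monomial_span \<subseteq> monomial_span \<and>
      (\<forall>u\<in>monomial_span. \<forall>v\<in>monomial_span. \<forall>n. mode Y u n v \<in> monomial_span)"
    by (auto simp: mode_def subspace_span T_monomial_span Y_monomial_span)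
  ultimately have "(\<lambda>W. subspace W \<and> T ` W \<subseteq> W \<and> (\<forall>u\<in>W. \<forall>v\<in>W. \<forall>n. mode Y u n v \<in> W))
      hull (insert vac (\<iota> ` B)) \<subseteq> monomial_span"
    by (rule hull_minimal)
  then show ?thesis using assms unfolding generates_def by blast
qed

lemma ordered_monomials_span:
  assumes "generates scale Y vac T (\<iota> ` B)"
  shows "span (ordered_monomials Y vac B \<iota> \<N>) = UNIV"
proof -
  have "monom_vec ` Collect normal \<subseteq> ordered_monomials Y vac B \<iota> \<N>"
    using normal_ordered_monomial by blast
  then have "span (monom_vec ` Collect normal) \<subseteq> span (ordered_monomials Y vac B \<iota> \<N>)"
    by (rule span_mono)
  with span_normal monomials_span[OF assms] show ?thesis by blast
qed

end

theorem corollary3p1: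
  fixes scale :: "'k::field \<Rightarrow> 'v::ab_group_add \<Rightarrow> 'v"
    and emb :: "complex \<Rightarrow> 'k"
    and Y :: "'v \<Rightarrow> ('v \<Rightarrow> 'v) fseries" and vac :: 'v and T :: "'v \<Rightarrow> 'v"
    and \<Delta> :: "'q::ab_group_add \<Rightarrow> 'q \<Rightarrow> complex set"
    and \<eta> :: "'q \<Rightarrow> 'q \<Rightarrow> complex"
    and Vg :: "'q \<Rightarrow> 'v set"
    and B :: "'b::linorder set" and \<iota> :: "'b \<Rightarrow> 'v"
    and \<N> :: "'b \<Rightarrow> 'b \<Rightarrow> complex"
  assumes gva: "GVA_charge_factor scale emb Y vac T \<Delta> \<eta> Vg"
    and nonzero: "\<And>a. a \<in> B \<Longrightarrow> \<iota> a \<noteq> 0"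
    and homogeneous: "\<And>a. a \<in> B \<Longrightarrow> \<exists>\<alpha>. \<iota> a \<in> Vg \<alpha>"
    and gen: "generates scale Y vac T (\<iota> ` B)"
    and sym: "\<And>a b. a \<in> B \<Longrightarrow> b \<in> B \<Longrightarrow> \<N> a b = \<N> b a"
    and bound: "\<And>a b \<alpha> \<beta>. a \<in> B \<Longrightarrow> b \<in> B \<Longrightarrow> \<iota> a \<in> Vg \<alpha> \<Longrightarrow> \<iota> b \<in> Vg \<beta> \<Longrightarrow>
      is_locality_bound scale emb \<Delta> (\<eta> \<alpha> \<beta>) \<alpha> \<beta> (Y (\<iota> a)) (Y (\<iota> b)) (\<N> a b)"
  shows "module.span scale (ordered_monomials Y vac B \<iota> \<N>) = UNIV"
proof -
  \<comment> \<open>The locality hypothesis holds for all charges of the generators, so any choice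
    of charges meets the assumptions of the locale.\<close>
  have "\<exists>\<chi>. \<forall>a\<in>B. \<iota> a \<in> Vg (\<chi> a)"
    using homogeneous by metis
  then obtain \<chi> where \<chi>: "\<And>a. a \<in> B \<Longrightarrow> \<iota> a \<in> Vg (\<chi> a)" by blast
  interpret GVA_charge_factor scale emb Y vac T \<Delta> \<eta> Vg by (rule gva)
  interpret GVA_generators scale emb Y vac T \<Delta> \<eta> Vg B \<iota> \<N> \<chi>
    by unfold_locales (use \<chi> sym bound in blast)+
  show ?thesis using gen by (rule ordered_monomials_span)
qed

end
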